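(* Let $\mathbb{R}^n$ be endowed with a norm $\|\cdot\|$ with dual norm $\|\cdot\|^*$. Suppose $\mathcal{C}\subseteq\mathbb{R}^n$ is a polytope and $F_1,\dots,F_m$ are the facets of $\mathcal{C}$ with facet-exposing directions $a_j$, $j=1,\dots,m$. Let $\sigma_j:=\sigma(a_j)$, $j=1,\dots,m$, be their gaps. For $F\in\mathrm{faces}(\mathcal{C})$ let $I(F):=\{j : F\subseteq F_j\}$. Then for $F\in\mathrm{faces}(\mathcal{C})$ with $F\subsetneq\mathcal{C}$, $$\mathrm{dist}(\mathrm{aff}(F),\mathcal{C}[F])\ \ge\ \frac{1}{\left\|\sum_{j\in I(F)} a_j/\sigma_j\right\|^*}.$$ Consequently, for $F\in\mathrm{faces}(\mathcal{C})$ it holds that $$\Phi(F,\mathcal{C})\ \ge\ \min_{G\in\mathrm{faces}(F),\ G\subsetneq\mathcal{C}}\ \frac{1}{\left\|\sum_{j\in I(G)} a_j/\sigma_j\right\|^*}.$$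
   Context: A polytope is the convex hull of a finite set of points. $\mathrm{vert}(\mathcal{C})$ is the set of vertices of $\mathcal{C}$, $\mathrm{faces}(\mathcal{C})$ is the set of nonempty faces (including $\mathcal{C}$ itself), and a facet is a face of dimension $\dim(\mathcal{C})-1$. $\mathrm{aff}$ denotes affine hull. For $G\in\mathrm{faces}(\mathcal{C})$, $G\neq\mathcal{C}$, $\mathcal{C}[G]:=\mathrm{conv}(\mathrm{vert}(\mathcal{C})\setminus G)$. For sets $S,T$, $\mathrm{dist}(S,T)=\min_{x\in S,\,y\in T}\|x-y\|$. The facial distance from $F\in\mathrm{faces}(\mathcal{C})$ is $\Phi(F,\mathcal{C}):=\min_{G\in\mathrm{faces}(F),\ G\subsetneq\mathcal{C}}\mathrm{dist}(G,\mathcal{C}[G])$. The dual norm is $\|a\|^*:=\max\{\langle a,x\rangle:\|x\|\le1\}$. For $F\in\mathrm{faces}(\mathcal{C})$, $F\subsetneq\mathcal{C}$, a vector $a\in\mathbb{R}^n$ is a face-exposing direction of $F$ if $\|a\|^*=1$ and $F=\mathrm{argmin}\{\langle a,x\rangle : x\in\mathcal{C}\}$; it is called a facet-exposing direction when $F$ is a facet. When this is the case, the gap of $a$ is defined as $$\sigma(a):=\min\{\langle a,v\rangle : v\in\mathrm{vert}(\mathcal{C})\setminus F\}=\min\{\langle a,x\rangle: x\in\mathcal{C}[F]\}>0.$$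
   Formalization: The gap is taken as σ(a) = min{⟨a,v⟩ : v ∈ vert(C)∖F} − min{⟨a,x⟩ : x ∈ C}; without the subtracted minimum the claim fails, e.g. for C=[5,6], F={5}, a=1 (bound 6, distance 1). *)

theory Defs
  imports "HOL-Analysis.Analysis"
begin

definition is_norm :: "(real^'n \<Rightarrow> real) \<Rightarrow> bool" where
  "is_norm N \<longleftrightarrow>
     (\<forall>x. 0 \<le> N x) \<and> (\<forall>x. N x = 0 \<longleftrightarrow> x = 0) \<and>
     (\<forall>c x. N (c *\<^sub>R x) = \<bar>c\<bar> * N x) \<and> (\<forall>x y. N (x + y) \<le> N x + N y)"

(* The unit ball of N is compact, so the supremum is a maximum. *)
definition dual_norm :: "(real^'n \<Rightarrow> real) \<Rightarrow> real^'n \<Rightarrow> real" where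
  "dual_norm N a = Sup {a \<bullet> x | x. N x \<le> 1}"

(* The counterpart of setdist for the norm N.  The infimum is attained whenever S and T are
   nonempty, S is closed and T is compact, which covers all the uses below. *)
definition norm_dist :: "(real^'n \<Rightarrow> real) \<Rightarrow> (real^'n) set \<Rightarrow> (real^'n) set \<Rightarrow> real" where
  "norm_dist N S T = Inf {N (x - y) | x y. x \<in> S \<and> y \<in> T}"

definition vert :: "(real^'n) set \<Rightarrow> (real^'n) set" where
  "vert C = {v. v extreme_point_of C}"

(* Unlike face_of, this excludes the empty face. *)
definition faces :: "(real^'n) set \<Rightarrow> (real^'n) set set" where
  "faces C = {F. F face_of C \<and> F \<noteq> {}}"

(* The set C[G] = conv (vert C - G). *)
definition conv_minus :: "(real^'n) set \<Rightarrow> (real^'n) set \<Rightarrow> (real^'n) set" where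
  "conv_minus C G = convex hull (vert C - G)"

(* A polytope has finitely many faces, so Min ranges over a finite set.  It ranges over the
   empty set only if F = C is a single point. *)
definition facial_dist :: "(real^'n \<Rightarrow> real) \<Rightarrow> (real^'n) set \<Rightarrow> (real^'n) set \<Rightarrow> real" where
  "facial_dist N F C =
     Min ((\<lambda>G. norm_dist N G (conv_minus C G)) ` {G \<in> faces F. G \<subset> C})"

definition argmin_set :: "(real^'n) set \<Rightarrow> real^'n \<Rightarrow> (real^'n) set" where
  "argmin_set C a = {x. is_arg_min (\<lambda>x. a \<bullet> x) (\<lambda>x. x \<in> C) x}"

definition face_exposing ::
  "(real^'n \<Rightarrow> real) \<Rightarrow> (real^'n) set \<Rightarrow> (real^'n) set \<Rightarrow> real^'n \<Rightarrow> bool" where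
  "face_exposing N C F a \<longleftrightarrow>
     F \<in> faces C \<and> F \<subset> C \<and> dual_norm N a = 1 \<and> F = argmin_set C a"

definition facet_exposing ::
  "(real^'n \<Rightarrow> real) \<Rightarrow> (real^'n) set \<Rightarrow> (real^'n) set \<Rightarrow> real^'n \<Rightarrow> bool" where
  "facet_exposing N C F a \<longleftrightarrow> F facet_of C \<and> face_exposing N C F a"

(* The gap is measured from the value of a on the face it exposes, i.e. from its minimum over C.
   When that minimum is 0, this is the plain minimum of a over the remaining vertices
   (see gap_normalized); without the subtraction the gap would not be invariant under
   translations of C and could fail to be positive. *)
definition gap :: "(real^'n) set \<Rightarrow> real^'n \<Rightarrow> real" where
  "gap C a = Min ((\<lambda>v. a \<bullet> v) ` (vert C - argmin_set C a)) - (INF x\<in>C. a \<bullet> x)"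

lemma finite_vert: "polytope C \<Longrightarrow> finite (vert C)"
  unfolding vert_def by (simp add: finite_polyhedron_extreme_points polytope_imp_polyhedron)

lemma argmin_set_Inf:
  assumes "x \<in> argmin_set C a"
  shows "(INF x\<in>C. a \<bullet> x) = a \<bullet> x"
  by (rule cInf_eq_minimum) (use assms in \<open>auto simp: argmin_set_def is_arg_min_def not_less\<close>)

lemma vert_minus_nonempty:
  assumes "polytope C" "F \<in> faces C" "F \<subset> C"
  shows "vert C - F \<noteq> {}"
proof
  assume "vert C - F = {}"
  moreover have "C = convex hull vert C" unfolding vert_def
    using assms(1) by (intro Krein_Milman_Minkowski polytope_imp_compact polytope_imp_convex)
  moreover have "convex F" using assms(2) by (auto simp: faces_def dest: face_of_imp_convex)
  ultimately have "C \<subseteq> F" by (metis Diff_eq_empty_iff hull_minimal)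
  with assms(3) show False by blast
qed

lemma gap_pos:
  assumes "polytope C" "face_exposing N C F a"
  shows "gap C a > 0"
proof -
  have F: "F \<in> faces C" "F \<subset> C" "F = argmin_set C a"
    using assms(2) by (auto simp: face_exposing_def)
  obtain x where x: "x \<in> argmin_set C a" using F by (auto simp: faces_def)
  have "Min ((\<lambda>v. a \<bullet> v) ` (vert C - argmin_set C a)) \<in> (\<lambda>v. a \<bullet> v) ` (vert C - argmin_set C a)"
    using vert_minus_nonempty[OF assms(1) F(1,2)] F(3) finite_vert[OF assms(1)]
    by (intro Min_in) auto
  then obtain v where v: "v \<in> vert C" "v \<notin> argmin_set C a"
    "Min ((\<lambda>v. a \<bullet> v) ` (vert C - argmin_set C a)) = a \<bullet> v" by auto
  have "v \<in> C" using v(1) by (auto simp: vert_def extreme_point_of_def)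
  then have "a \<bullet> x < a \<bullet> v"
    using v(2) x by (auto simp: argmin_set_def is_arg_min_def not_less)
  then show ?thesis by (simp add: gap_def v(3) argmin_set_Inf[OF x])
qed

lemma gap_eq_conv_minus:
  assumes "polytope C" "face_exposing N C F a"
  shows "gap C a = (INF x\<in>conv_minus C F. a \<bullet> x) - (INF x\<in>C. a \<bullet> x)"
proof -
  have F: "F \<in> faces C" "F \<subset> C" "F = argmin_set C a"
    using assms(2) by (auto simp: face_exposing_def)
  let ?V = "vert C - F"
  let ?m = "Min ((\<lambda>v. a \<bullet> v) ` ?V)"
  have V: "finite ?V" "?V \<noteq> {}"
    using vert_minus_nonempty[OF assms(1) F(1,2)] finite_vert[OF assms(1)] by auto
  have "?m \<in> (\<lambda>v. a \<bullet> v) ` ?V" using V by (intro Min_in) auto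
  then have "?m \<in> (\<lambda>x. a \<bullet> x) ` conv_minus C F"
    unfolding conv_minus_def using hull_subset[of ?V convex] by blast
  moreover have "conv_minus C F \<subseteq> {x. a \<bullet> x \<ge> ?m}"
    unfolding conv_minus_def
    by (rule hull_minimal) (use V in \<open>auto simp: convex_halfspace_ge\<close>)
  ultimately have "(INF x\<in>conv_minus C F. a \<bullet> x) = ?m"
    by (intro cInf_eq_minimum) auto
  then show ?thesis by (simp add: gap_def F(3))
qed

lemma gap_normalized:
  assumes "face_exposing N C F a" "x \<in> F" "a \<bullet> x = 0"
  shows "gap C a = Min ((\<lambda>v. a \<bullet> v) ` (vert C - F))"
  using assms argmin_set_Inf[of x C a] by (auto simp: gap_def face_exposing_def)

end

theory Submission
  imports Defs
begin

text \<open>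
  For a proper face \<open>F\<close>, rescale the directions of the facets through \<open>F\<close> so that their gaps
  become 1, and add them up: \<open>b = (\<Sum>j\<in>I F. a j /\<^sub>R \<sigma> j)\<close>.  Each summand is constant on
  \<open>affine hull F\<close>, with its minimum over \<open>C\<close> as value, so every vertex lies at least as high
  on every summand as \<open>affine hull F\<close> does.  A vertex outside \<open>F\<close> misses one of these
  facets, because a proper face of a polytope is the intersection of the facets containing it
  (\<open>face_of_polyhedron\<close>), and there it lies higher by at least one whole gap.  Hence \<open>b\<close>
  increases by at least 1 from any point of \<open>affine hull F\<close> to any vertex outside \<open>F\<close>, and by
  convexity to any point of \<open>conv_minus C F\<close>.  The duality inequality \<open>b \<bullet> z \<le> dual_norm N b * N z\<close>
  turns this separation into a lower bound for the distance.

  The bound on the facial distance then holds term by term, since the faces of \<open>F\<close> are faces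
  of \<open>C\<close> and \<open>G \<subseteq> affine hull G\<close>.
\<close>

section \<open>The duality inequality\<close>

text \<open>Equivalence of norms, in the one direction that makes the dual unit ball bounded: \<open>N\<close> is
  convex, hence continuous, and so attains a positive minimum on the Euclidean unit sphere.\<close>

lemma is_norm_ge_euclidean:
  fixes N :: "real^'n \<Rightarrow> real"
  assumes N: "is_norm N"
  obtains c where "c > 0" "\<And>x. c * norm x \<le> N x"
proof -
  have scale: "N (r *\<^sub>R x) = \<bar>r\<bar> * N x" for r x using N by (auto simp: is_norm_def)
  have tri: "N (x + y) \<le> N x + N y" for x y using N by (auto simp: is_norm_def)
  have "convex_on UNIV N"
  proof (rule convex_onI)
    fix t :: real and x y :: "real^'n"
    assume t: "0 < t" "t < 1"
    have "N ((1 - t) *\<^sub>R x + t *\<^sub>R y) \<le> N ((1 - t) *\<^sub>R x) + N (t *\<^sub>R y)" by (rule tri)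
    then show "N ((1 - t) *\<^sub>R x + t *\<^sub>R y) \<le> (1 - t) * N x + t * N y"
      using t by (simp add: scale)
  qed simp
  then have "continuous_on UNIV N" by (intro convex_on_continuous) auto
  then have "continuous_on (sphere 0 1) N" by (rule continuous_on_subset) simp
  moreover have "sphere (0::real^'n) 1 \<noteq> {}" by (simp add: sphere_eq_empty)
  ultimately obtain u where u: "u \<in> sphere 0 1" "\<And>x. x \<in> sphere 0 1 \<Longrightarrow> N u \<le> N x"
    using continuous_attains_inf[of "sphere 0 1" N] by auto
  show thesis
  proof
    have "u \<noteq> 0" using u(1) by auto
    then show "N u > 0" using N by (metis is_norm_def less_eq_real_def)
    show "N u * norm x \<le> N x" for x
    proof (cases "x = 0")
      case False
      then have "N u \<le> N (inverse (norm x) *\<^sub>R x)" by (intro u(2)) auto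
      then show ?thesis using False by (simp add: scale field_simps)
    qed (use N in \<open>auto simp: is_norm_def\<close>)
  qed
qed

lemma inner_le_dual_norm:
  fixes N :: "real^'n \<Rightarrow> real"
  assumes N: "is_norm N"
  shows "b \<bullet> z \<le> dual_norm N b * N z"
proof (cases "z = 0")
  case True
  moreover have "N 0 = 0" using N by (simp add: is_norm_def)
  ultimately show ?thesis by simp
next
  case False
  then have pos: "N z > 0" using N by (metis is_norm_def less_eq_real_def)
  obtain c where c: "c > 0" "\<And>x. c * norm x \<le> N x" using is_norm_ge_euclidean[OF N] by blast
  \<comment> \<open>The real-valued supremum defining \<open>dual_norm\<close> dominates its set only if that set is bounded.\<close>
  have "bdd_above {b \<bullet> x | x. N x \<le> 1}"
  proof (rule bdd_aboveI, clarify)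
    fix x assume "N x \<le> 1"
    then have "norm x \<le> 1 / c" using c(1) c(2)[of x] by (simp add: field_simps)
    then have "norm b * norm x \<le> norm b * (1 / c)" by (intro mult_left_mono) auto
    then show "b \<bullet> x \<le> norm b * (1 / c)"
      using norm_cauchy_schwarz[of b x] by linarith
  qed
  moreover have "N (inverse (N z) *\<^sub>R z) \<le> 1"
    using N False by (simp add: is_norm_def)
  ultimately have "b \<bullet> (inverse (N z) *\<^sub>R z) \<le> dual_norm N b"
    unfolding dual_norm_def by (intro cSup_upper) blast+
  then show ?thesis using pos by (simp add: field_simps)
qed

lemma norm_dist_ge:
  assumes "S \<noteq> {}" "T \<noteq> {}" "\<And>x y. x \<in> S \<Longrightarrow> y \<in> T \<Longrightarrow> r \<le> N (x - y)"
  shows "r \<le> norm_dist N S T"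
  unfolding norm_dist_def using assms by (intro cInf_greatest) auto

text \<open>A functional that separates two points by at least 1 keeps them apart by the reciprocal of
  its dual norm.  That dual norm is positive here: \<open>b\<close> does not vanish on \<open>y - x\<close>.\<close>

lemma norm_diff_ge_inverse_dual_norm:
  fixes N :: "real^'n \<Rightarrow> real"
  assumes N: "is_norm N" and sep: "b \<bullet> x + 1 \<le> b \<bullet> y"
  shows "1 / dual_norm N b \<le> N (x - y)"
proof -
  have "N (y - x) = N (x - y)"
  proof -
    have "N ((-1) *\<^sub>R (x - y)) = \<bar>-1\<bar> * N (x - y)" using N unfolding is_norm_def by blast
    then show ?thesis by simp
  qed
  then have one: "1 \<le> dual_norm N b * N (x - y)"
    using inner_le_dual_norm[OF N, of b "y - x"] sep by (simp add: inner_diff_right)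
  moreover have "0 \<le> N (x - y)" using N by (auto simp: is_norm_def)
  ultimately have "0 < dual_norm N b"
    by (smt (verit) mult_nonpos_nonneg)
  then show ?thesis using one by (simp add: field_simps)
qed

section \<open>Separation by the facets through a face\<close>

lemma argmin_set_le:
  assumes "x \<in> argmin_set C a" "y \<in> C"
  shows "a \<bullet> x \<le> a \<bullet> y"
  using assms by (auto simp: argmin_set_def is_arg_min_def not_less)

lemma inner_ge_gap:
  assumes "polytope C" "x \<in> argmin_set C a" "v \<in> vert C" "v \<notin> argmin_set C a"
  shows "a \<bullet> x + gap C a \<le> a \<bullet> v"
proof -
  have "Min ((\<lambda>v. a \<bullet> v) ` (vert C - argmin_set C a)) \<le> a \<bullet> v"
    using assms finite_vert by (intro Min_le) auto
  then show ?thesis by (simp add: gap_def argmin_set_Inf[OF assms(2)])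
qed

lemma inner_const_on_affine_hull:
  fixes b :: "'a::real_inner"
  assumes "\<And>x. x \<in> S \<Longrightarrow> b \<bullet> x = r" "x \<in> affine hull S"
  shows "b \<bullet> x = r"
proof -
  have "affine hull S \<subseteq> {x. b \<bullet> x = r}"
    by (rule hull_minimal) (use assms(1) in \<open>auto intro: affine_hyperplane\<close>)
  then show ?thesis using assms(2) by auto
qed

text \<open>At a vertex outside \<open>F\<close> every summand of \<open>b\<close> exceeds its value on \<open>affine hull F\<close> by a
  nonnegative multiple of its gap, and the summand of a face \<open>H k\<close> that misses the vertex by at
  least one gap.  A half-space
  containing these vertices contains their convex hull.\<close>

lemma unit_separation:
  fixes C :: "(real^'n) set"
  assumes C: "polytope C"
    and J: "finite J"
    and expose: "\<And>j. j \<in> J \<Longrightarrow> face_exposing N C (H j) (a j)"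
    and sub: "\<And>j. j \<in> J \<Longrightarrow> F \<subseteq> H j"
    and cut: "\<And>v. v \<in> vert C \<Longrightarrow> v \<notin> F \<Longrightarrow> \<exists>j\<in>J. v \<notin> H j"
    and x: "x \<in> affine hull F" and y: "y \<in> conv_minus C F"
  defines "b \<equiv> \<Sum>j\<in>J. a j /\<^sub>R gap C (a j)"
  shows "b \<bullet> x + 1 \<le> b \<bullet> y"
proof -
  have pos: "gap C (a j) > 0" if "j \<in> J" for j
    using gap_pos[OF C expose[OF that]] .
  have H: "H j = argmin_set C (a j)" if "j \<in> J" for j
    using expose[OF that] by (simp add: face_exposing_def)
  have "F \<noteq> {}" using x by auto
  then obtain p where p: "p \<in> F" by blast
  have p_min: "p \<in> argmin_set C (a j)" if "j \<in> J" for j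
    using sub[OF that] H[OF that] p by blast
  have ax: "a j \<bullet> x = a j \<bullet> p" if j: "j \<in> J" for j
  proof (rule inner_const_on_affine_hull[OF _ x])
    fix q assume "q \<in> F"
    then have "q \<in> argmin_set C (a j)" using sub[OF j] H[OF j] by blast
    then show "a j \<bullet> q = a j \<bullet> p"
      using argmin_set_Inf[of q C "a j"] argmin_set_Inf[OF p_min[OF j]] by simp
  qed
  have b_diff: "b \<bullet> z - b \<bullet> x = (\<Sum>j\<in>J. (a j \<bullet> z - a j \<bullet> p) / gap C (a j))" for z
    by (simp add: b_def inner_sum_left ax diff_divide_distrib sum_subtractf divide_inverse
        algebra_simps)
  have "1 \<le> b \<bullet> v - b \<bullet> x" if v: "v \<in> vert C - F" for v
  proof -
    have "v \<in> C" using v by (auto simp: vert_def extreme_point_of_def)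
    then have nonneg: "0 \<le> (a j \<bullet> v - a j \<bullet> p) / gap C (a j)" if "j \<in> J" for j
      using argmin_set_le[OF p_min[OF that]] pos[OF that] by simp
    obtain k where k: "k \<in> J" "v \<notin> H k" using cut v by blast
    have "gap C (a k) \<le> a k \<bullet> v - a k \<bullet> p"
      using inner_ge_gap[OF C p_min[OF k(1)], of v] v k(2) H[OF k(1)] by auto
    then have "1 \<le> (a k \<bullet> v - a k \<bullet> p) / gap C (a k)" using pos[OF k(1)] by simp
    also have "\<dots> \<le> (\<Sum>j\<in>J. (a j \<bullet> v - a j \<bullet> p) / gap C (a j))"
      by (rule member_le_sum[OF k(1) _ J]) (use nonneg in auto)
    finally show ?thesis by (simp add: b_diff)
  qed
  then have "vert C - F \<subseteq> {z. b \<bullet> z \<ge> b \<bullet> x + 1}" by force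
  then have "conv_minus C F \<subseteq> {z. b \<bullet> z \<ge> b \<bullet> x + 1}"
    unfolding conv_minus_def by (rule hull_minimal) (rule convex_halfspace_ge)
  then show ?thesis using y by auto
qed

section \<open>The bounds on the distances\<close>

theorem theorem4p1:
  fixes N :: "real^'n \<Rightarrow> real"
    and C :: "(real^'n) set"
    and m :: nat
    and Fs :: "nat \<Rightarrow> (real^'n) set"
    and a :: "nat \<Rightarrow> real^'n"
    and \<sigma> :: "nat \<Rightarrow> real"
    and I :: "(real^'n) set \<Rightarrow> nat set"
  assumes "is_norm N"
    and "polytope C"
    and "bij_betw Fs {1..m} {F. F facet_of C}"
    and "\<And>j. j \<in> {1..m} \<Longrightarrow> facet_exposing N C (Fs j) (a j)"
    and "\<And>j. j \<in> {1..m} \<Longrightarrow> \<sigma> j = gap C (a j)"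
    and "\<And>F. F \<in> faces C \<Longrightarrow> I F = {j \<in> {1..m}. F \<subseteq> Fs j}"
  shows "(\<forall>F \<in> faces C. F \<subset> C \<longrightarrow>
            norm_dist N (affine hull F) (conv_minus C F)
              \<ge> 1 / dual_norm N (\<Sum>j \<in> I F. a j /\<^sub>R \<sigma> j)) \<and>
         (\<forall>F \<in> faces C.
            facial_dist N F C
              \<ge> Min ((\<lambda>G. 1 / dual_norm N (\<Sum>j \<in> I G. a j /\<^sub>R \<sigma> j)) ` {G \<in> faces F. G \<subset> C}))"
proof -
  let ?b = "\<lambda>F. \<Sum>j \<in> I F. a j /\<^sub>R \<sigma> j"
  \<comment> \<open>With \<open>S = affine hull F\<close> this is the first bound; \<open>S = F\<close> serves the facial distance.\<close>
  have main: "1 / dual_norm N (?b F) \<le> norm_dist N S (conv_minus C F)"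
    if F: "F \<in> faces C" "F \<subset> C" and S: "S \<noteq> {}" "S \<subseteq> affine hull F" for F S
  proof (rule norm_dist_ge)
    show "S \<noteq> {}" by fact
    show "conv_minus C F \<noteq> {}"
      using vert_minus_nonempty[OF assms(2) F] by (simp add: conv_minus_def)
    fix x y assume x: "x \<in> S" and y: "y \<in> conv_minus C F"
    have IF: "I F = {j \<in> {1..m}. F \<subseteq> Fs j}" using assms(6) F(1) .
    have b: "?b F = (\<Sum>j \<in> I F. a j /\<^sub>R gap C (a j))"
      by (rule sum.cong) (auto simp: IF assms(5))
    have facets: "F = \<Inter>{H. H facet_of C \<and> F \<subseteq> H}"
      using F by (intro face_of_polyhedron polytope_imp_polyhedron assms(2)) (auto simp: faces_def)
    have cut: "\<exists>j\<in>I F. v \<notin> Fs j" if "v \<notin> F" for v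
    proof -
      have "v \<notin> \<Inter>{H. H facet_of C \<and> F \<subseteq> H}"
        by (subst facets[symmetric]) (rule that)
      then obtain H where H: "H facet_of C" "F \<subseteq> H" "v \<notin> H" by blast
      then have "H \<in> Fs ` {1..m}" using assms(3) by (simp add: bij_betw_def)
      then obtain j where "j \<in> {1..m}" "Fs j = H" by blast
      then show ?thesis using H IF by auto
    qed
    have "?b F \<bullet> x + 1 \<le> ?b F \<bullet> y"
      unfolding b
    proof (rule unit_separation[OF assms(2), where N = N and H = Fs and F = F])
      show "face_exposing N C (Fs j) (a j)" if "j \<in> I F" for j
        using assms(4)[of j] that by (auto simp: IF facet_exposing_def)
    qed (use cut x y S(2) in \<open>auto simp: IF\<close>)
    then show "1 / dual_norm N (?b F) \<le> N (x - y)"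
      by (rule norm_diff_ge_inverse_dual_norm[OF assms(1)])
  qed
  show ?thesis
  proof (intro conjI ballI impI)
    fix F assume F: "F \<in> faces C" "F \<subset> C"
    then show "1 / dual_norm N (?b F) \<le> norm_dist N (affine hull F) (conv_minus C F)"
      by (intro main) (auto simp: faces_def)
  next
    fix F assume F: "F \<in> faces C"
    let ?\<G> = "{G \<in> faces F. G \<subset> C}"
    have faces: "faces F \<subseteq> faces C"
      using F by (auto simp: faces_def intro: face_of_trans)
    moreover have "finite (faces C)"
      using finite_polytope_faces[OF assms(2)] by (simp add: faces_def)
    ultimately have fin: "finite ?\<G>" by (auto intro: finite_subset)
    show "Min ((\<lambda>G. 1 / dual_norm N (?b G)) ` ?\<G>) \<le> facial_dist N F C"
    proof (cases "?\<G> = {}")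
      case True
      \<comment> \<open>\<open>F = C\<close> is a single point, and both sides are \<open>Min {}\<close>.\<close>
      then show ?thesis unfolding facial_dist_def True by simp
    next
      case False
      have "Min ((\<lambda>G. 1 / dual_norm N (?b G)) ` ?\<G>) \<le> norm_dist N G (conv_minus C G)"
        if G: "G \<in> ?\<G>" for G
      proof -
        have "Min ((\<lambda>G. 1 / dual_norm N (?b G)) ` ?\<G>) \<le> 1 / dual_norm N (?b G)"
          using fin G by (intro Min_le) auto
        also have "\<dots> \<le> norm_dist N G (conv_minus C G)"
          using G faces by (intro main) (auto simp: faces_def hull_subset)
        finally show ?thesis .
      qed
      then show ?thesis
        unfolding facial_dist_def using fin False by (intro Min.boundedI) auto
    qed
  qed
qed

end
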